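(* Let $X$ be a second-countable locally compact Hausdorff space. Then $\mathcal{M}_{\text{reg}}$, the assignment sending each open subset $U\subset X$ to the set $\mathcal{M}_{\text{reg}}(U)$ of regular Borel measures on $U$ together with restriction of measures, is a sub-sheaf of $\mathcal{M}$ on $X$, where $\mathcal{M}$ is the sheaf of Borel measures.
   Context: For an open subset $U\subset X$, $\mathcal{M}(U)$ is the set of Borel measures $\mu:\mathcal{B}(U)\to[0,\infty]$ and $\mathcal{M}_{\text{reg}}(U)\subset\mathcal{M}(U)$ is the subset of regular ones. A Borel measure is regular if it is inner regular, outer regular and finite on compact sets. For open $V\subset U$ the restriction is $\mu\mapsto\mu|_V$, $\mu|_V(B)=\mu(B)$ for Borel $B\subset V$; the restriction maps of $\mathcal{M}_{\text{reg}}$ are those of $\mathcal{M}$. A presheaf of sets on $X$ is a contravariant functor from the poset of open subsets of $X$ (ordered by inclusion) to sets. A presheaf $\mathcal{F}$ is a sheaf if for every open $W\subset X$ and every open cover $\mathcal{U}$ of $W$: (Locality) if $s,t\in\mathcal{F}(W)$ satisfy $s|_U=t|_U$ for all $U\in\mathcal{U}$, then $s=t$; (Gluing) if $s_U\in\mathcal{F}(U)$, $U\in\mathcal{U}$, satisfy $s_U|_{U\cap V}=s_V|_{U\cap V}$ for all $U,V\in\mathcal{U}$, then there is $s\in\mathcal{F}(W)$ with $s|_U=s_U$ for all $U\in\mathcal{U}$. A sub-sheaf $\mathcal{H}$ of a sheaf $\mathcal{F}$ is a sheaf with $\mathcal{H}(U)\subset\mathcal{F}(U)$ for all open $U$, such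 that the inclusions commute with the restriction maps. *)

theory Defs
  imports "HOL-Analysis.Analysis"
begin

text \<open>
  A presheaf of sets on \<open>X\<close> is given by its section sets \<open>F U\<close> and its restriction maps
  \<open>r U V : F U \<rightarrow> F V\<close> for open \<open>V \<subseteq> U\<close>. Only the values of \<open>F\<close> on open sets and those of
  \<open>r U V\<close> on \<open>F U\<close> matter.
\<close>

definition presheaf ::
  "'a topology \<Rightarrow> ('a set \<Rightarrow> 'b set) \<Rightarrow> ('a set \<Rightarrow> 'a set \<Rightarrow> 'b \<Rightarrow> 'b) \<Rightarrow> bool" where
  "presheaf X F r \<longleftrightarrow>
     (\<forall>U V. openin X U \<longrightarrow> openin X V \<longrightarrow> V \<subseteq> U \<longrightarrow> (\<forall>s\<in>F U. r U V s \<in> F V)) \<and>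
     (\<forall>U. openin X U \<longrightarrow> (\<forall>s\<in>F U. r U U s = s)) \<and>
     (\<forall>U V W. openin X U \<longrightarrow> openin X V \<longrightarrow> openin X W \<longrightarrow> W \<subseteq> V \<longrightarrow> V \<subseteq> U \<longrightarrow>
        (\<forall>s\<in>F U. r V W (r U V s) = r U W s))"

definition open_cover :: "'a topology \<Rightarrow> 'a set \<Rightarrow> 'a set set \<Rightarrow> bool" where
  "open_cover X W \<U> \<longleftrightarrow> (\<forall>U\<in>\<U>. openin X U) \<and> \<Union>\<U> = W"

definition sheaf ::
  "'a topology \<Rightarrow> ('a set \<Rightarrow> 'b set) \<Rightarrow> ('a set \<Rightarrow> 'a set \<Rightarrow> 'b \<Rightarrow> 'b) \<Rightarrow> bool" where
  "sheaf X F r \<longleftrightarrow>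
     presheaf X F r \<and>
     (\<forall>W \<U>. openin X W \<longrightarrow> open_cover X W \<U> \<longrightarrow>
        (\<forall>s\<in>F W. \<forall>t\<in>F W. (\<forall>U\<in>\<U>. r W U s = r W U t) \<longrightarrow> s = t)) \<and>
     (\<forall>W \<U>. openin X W \<longrightarrow> open_cover X W \<U> \<longrightarrow>
        (\<forall>\<sigma>. (\<forall>U\<in>\<U>. \<sigma> U \<in> F U) \<longrightarrow>
             (\<forall>U\<in>\<U>. \<forall>V\<in>\<U>. r U (U \<inter> V) (\<sigma> U) = r V (U \<inter> V) (\<sigma> V)) \<longrightarrow>
             (\<exists>s\<in>F W. \<forall>U\<in>\<U>. r W U s = \<sigma> U)))"

definition subsheaf ::
  "'a topology \<Rightarrow> ('a set \<Rightarrow> 'b set) \<Rightarrow> ('a set \<Rightarrow> 'a set \<Rightarrow> 'b \<Rightarrow> 'b) \<Rightarrow>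
   ('a set \<Rightarrow> 'b set) \<Rightarrow> ('a set \<Rightarrow> 'a set \<Rightarrow> 'b \<Rightarrow> 'b) \<Rightarrow> bool" where
  "subsheaf X H rH F rF \<longleftrightarrow>
     sheaf X F rF \<and> sheaf X H rH \<and>
     (\<forall>U. openin X U \<longrightarrow> H U \<subseteq> F U) \<and>
     (\<forall>U V. openin X U \<longrightarrow> openin X V \<longrightarrow> V \<subseteq> U \<longrightarrow> (\<forall>s\<in>H U. rH U V s = rF U V s))"

definition borel_sets :: "'a topology \<Rightarrow> 'a set set" where
  "borel_sets Y = sigma_sets (topspace Y) {U. openin Y U}"

definition borel_measures :: "'a topology \<Rightarrow> 'a measure set" where
  "borel_measures Y = {\<mu>. space \<mu> = topspace Y \<and> sets \<mu> = borel_sets Y}"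

text \<open>
  Inner and outer regularity are required at all Borel sets. The supremum below is only meaningful
  if compact sets are Borel (e.g. in Hausdorff spaces), as \<^const>\<open>emeasure\<close> is \<open>0\<close> off
  the \<open>\<sigma>\<close>-algebra.
\<close>

definition inner_regular_measure :: "'a topology \<Rightarrow> 'a measure \<Rightarrow> bool" where
  "inner_regular_measure Y \<mu> \<longleftrightarrow>
     (\<forall>B\<in>borel_sets Y. emeasure \<mu> B = (SUP K\<in>{K. compactin Y K \<and> K \<subseteq> B}. emeasure \<mu> K))"

definition outer_regular_measure :: "'a topology \<Rightarrow> 'a measure \<Rightarrow> bool" where
  "outer_regular_measure Y \<mu> \<longleftrightarrow>
     (\<forall>B\<in>borel_sets Y. emeasure \<mu> B = (INF U\<in>{U. openin Y U \<and> B \<subseteq> U}. emeasure \<mu> U))"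

definition regular_borel_measures :: "'a topology \<Rightarrow> 'a measure set" where
  "regular_borel_measures Y =
     {\<mu> \<in> borel_measures Y. inner_regular_measure Y \<mu> \<and> outer_regular_measure Y \<mu> \<and>
        (\<forall>K. compactin Y K \<longrightarrow> emeasure \<mu> K < \<infinity>)}"

definition measure_sections :: "'a topology \<Rightarrow> 'a set \<Rightarrow> 'a measure set" where
  "measure_sections X U = borel_measures (subtopology X U)"

definition regular_measure_sections :: "'a topology \<Rightarrow> 'a set \<Rightarrow> 'a measure set" where
  "regular_measure_sections X U = regular_borel_measures (subtopology X U)"

definition measure_restriction :: "'a set \<Rightarrow> 'a set \<Rightarrow> 'a measure \<Rightarrow> 'a measure" where
  "measure_restriction U V \<mu> = restrict_space \<mu> V"

lemma borel_sets_subtopology: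
  assumes "openin X V"
  shows "borel_sets (subtopology X V) = (\<inter>) V ` borel_sets X"
proof -
  have V: "V \<subseteq> topspace X"
    using assms by (rule openin_subset)
  have eq: "{T. openin (subtopology X V) T} = (\<inter>) V ` {U. openin X U}"
    by (auto simp: openin_subtopology)
  have "V \<in> sigma_sets (topspace X) {U. openin X U}"
    using assms by (auto intro: sigma_sets.Basic)
  from sigma_sets_Int[OF this V] show ?thesis
    using V by (simp add: borel_sets_def eq inf.absorb2)
qed

lemma measure_restriction:
  assumes \<mu>: "\<mu> \<in> measure_sections X U" and U: "openin X U" and V: "openin X V" and "V \<subseteq> U"
  shows "measure_restriction U V \<mu> \<in> measure_sections X V"
    and "B \<in> borel_sets (subtopology X V) \<Longrightarrow> emeasure (measure_restriction U V \<mu>) B = emeasure \<mu> B"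
proof -
  have sub: "U \<subseteq> topspace X" "V \<subseteq> topspace X"
    using U V openin_subset by auto
  have sp: "space \<mu> = U" and se: "sets \<mu> = borel_sets (subtopology X U)"
    using \<mu> sub by (auto simp: measure_sections_def borel_measures_def)
  have VU: "openin (subtopology X U) V"
    using V \<open>V \<subseteq> U\<close> by (auto simp: openin_subtopology)
  have st: "subtopology (subtopology X U) V = subtopology X V"
    using \<open>V \<subseteq> U\<close> by (simp add: subtopology_subtopology inf.absorb2)
  show "measure_restriction U V \<mu> \<in> measure_sections X V"
    using borel_sets_subtopology[OF VU] sub \<open>V \<subseteq> U\<close>
    by (auto simp: measure_restriction_def measure_sections_def borel_measures_def
        space_restrict_space sets_restrict_space sp se st)
  have Vm: "V \<inter> space \<mu> \<in> sets \<mu>"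
    using VU \<open>V \<subseteq> U\<close> by (simp add: sp se inf.absorb1 borel_sets_def sigma_sets.Basic)
  assume "B \<in> borel_sets (subtopology X V)"
  then have "B \<subseteq> V"
    using borel_sets_subtopology[OF V] by auto
  then show "emeasure (measure_restriction U V \<mu>) B = emeasure \<mu> B"
    using Vm by (simp add: measure_restriction_def emeasure_restrict_space)
qed

end

theory Submission
  imports Defs
begin

text \<open>
  By second countability an open cover of \<open>W\<close> may be replaced by a sequence \<open>A n\<close>, and
  disjointing it to \<open>D n\<close> gives \<open>\<mu> B = (\<Sum>n. \<mu> (B \<inter> D n))\<close>: this yields locality, and read as a
  definition it yields gluing. Regularity is a local property: the
  sets \<open>B \<inter> D n\<close> lie in members of the cover; inner approximation passes to disjoint finite unions
  and increasing limits, outer approximation to disjoint countable unions with errors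
  \<open>e / 2 ^ Suc n\<close>, and by local compactness a compact set is covered by finitely many open sets whose
  measure is finite because each lies in a compact subset of a member of the cover.
\<close>

section \<open>Borel sets and Borel measures on open subspaces\<close>

lemma sigma_algebra_borel_sets: "sigma_algebra (topspace Y) (borel_sets Y)"
  unfolding borel_sets_def by (rule sigma_algebra_sigma_sets) (auto dest: openin_subset)

lemma borel_sets_openin: "openin Y U \<Longrightarrow> U \<in> borel_sets Y"
  by (simp add: borel_sets_def sigma_sets.Basic)

text \<open>Compact sets are closed in a Hausdorff space. This keeps \<open>emeasure\<close> of a
  compact set from being the default value 0, so that the suprema in inner regularity mean what they
  should.\<close>

lemma borel_sets_compactin:
  assumes "Hausdorff_space Y" and "compactin Y K"
  shows "K \<in> borel_sets Y"
proof -
  interpret sigma_algebra "topspace Y" "borel_sets Y"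
    by (rule sigma_algebra_borel_sets)
  have K: "closedin Y K"
    using assms by (rule compactin_imp_closedin)
  then have "topspace Y - (topspace Y - K) \<in> borel_sets Y"
    by (intro compl_sets borel_sets_openin) blast
  then show ?thesis
    using closedin_subset[OF K] by (simp add: double_diff)
qed

text \<open>The open set \<open>V\<close> is itself Borel, so a trace on \<open>V\<close> is a Borel
  set of the whole space. This allows measures on different open sets to be compared on Borel sets
  of one space.\<close>

lemma borel_sets_open_subtopology_iff:
  assumes "openin Y V"
  shows "B \<in> borel_sets (subtopology Y V) \<longleftrightarrow> B \<in> borel_sets Y \<and> B \<subseteq> V"
proof -
  interpret sigma_algebra "topspace Y" "borel_sets Y"
    by (rule sigma_algebra_borel_sets)
  show ?thesis
    using assms by (auto simp: borel_sets_subtopology borel_sets_openin)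
qed

text \<open>This is \<open>measure_restriction\<close> with the whole space as the larger open set,
  phrased for an arbitrary topology \<open>Y\<close> that later becomes
  \<open>subtopology X W\<close>.\<close>

lemma borel_measures_restrict_space:
  assumes "\<mu> \<in> borel_measures Y" and "openin Y V"
  shows "restrict_space \<mu> V \<in> borel_measures (subtopology Y V)"
    and "B \<in> borel_sets Y \<Longrightarrow> B \<subseteq> V \<Longrightarrow> emeasure (restrict_space \<mu> V) B = emeasure \<mu> B"
  using measure_restriction[of \<mu> Y "topspace Y" V] assms openin_subset[OF assms(2)]
  by (simp_all add: measure_sections_def measure_restriction_def borel_sets_open_subtopology_iff)

lemma borel_measures_eqI:
  assumes "\<mu> \<in> borel_measures Y" and "\<nu> \<in> borel_measures Y"
    and "\<And>B. B \<in> borel_sets Y \<Longrightarrow> emeasure \<mu> B = emeasure \<nu> B"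
  shows "\<mu> = \<nu>"
  using assms by (intro measure_eqI) (auto simp: borel_measures_def)

section \<open>Regularity and its restriction to open subspaces\<close>

text \<open>The reverse inequality is monotonicity, so only the approximation from below remains to
  be shown.\<close>

lemma inner_regular_measureI:
  assumes "\<mu> \<in> borel_measures Y"
    and "\<And>B. B \<in> borel_sets Y \<Longrightarrow>
      emeasure \<mu> B \<le> (SUP K\<in>{K. compactin Y K \<and> K \<subseteq> B}. emeasure \<mu> K)"
  shows "inner_regular_measure Y \<mu>"
  unfolding inner_regular_measure_def using assms
  by (auto simp: borel_measures_def intro!: antisym[OF _ SUP_least] emeasure_mono)

lemma outer_regular_measureI:
  assumes "\<mu> \<in> borel_measures Y"
    and "\<And>B. B \<in> borel_sets Y \<Longrightarrow>
      (INF U\<in>{U. openin Y U \<and> B \<subseteq> U}. emeasure \<mu> U) \<le> emeasure \<mu> B"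
  shows "outer_regular_measure Y \<mu>"
  unfolding outer_regular_measure_def using assms
  by (auto simp: borel_measures_def borel_sets_openin intro!: antisym[OF INF_greatest] emeasure_mono)

text \<open>For \<open>B\<close> inside \<open>V\<close>, the compact subsets of \<open>B\<close>
  are the same in the subspace and in \<open>Y\<close>. An open \<open>U\<close> around
  \<open>B\<close> may be shrunk to \<open>U \<inter> V\<close>, which is open in both and has no
  larger measure.\<close>

lemma regular_borel_measures_restrict_space:
  assumes \<mu>: "\<mu> \<in> regular_borel_measures Y" and V: "openin Y V" and Haus: "Hausdorff_space Y"
  shows "restrict_space \<mu> V \<in> regular_borel_measures (subtopology Y V)"
proof -
  let ?S = "subtopology Y V"
  have \<mu>_borel: "\<mu> \<in> borel_measures Y" and inner: "inner_regular_measure Y \<mu>"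
    and outer: "outer_regular_measure Y \<mu>"
    and compact: "\<And>K. compactin Y K \<Longrightarrow> emeasure \<mu> K < \<infinity>"
    using \<mu> by (auto simp: regular_borel_measures_def)
  note restr = borel_measures_restrict_space[OF \<mu>_borel V]
  note borel_iff = borel_sets_open_subtopology_iff[OF V]
  have inner': "inner_regular_measure ?S (restrict_space \<mu> V)"
    unfolding inner_regular_measure_def
  proof
    fix B assume B: "B \<in> borel_sets ?S"
    then have eq: "{K. compactin ?S K \<and> K \<subseteq> B} = {K. compactin Y K \<and> K \<subseteq> B}"
      by (auto simp: compactin_subtopology borel_iff)
    show "emeasure (restrict_space \<mu> V) B =
        (SUP K\<in>{K. compactin ?S K \<and> K \<subseteq> B}. emeasure (restrict_space \<mu> V) K)"
      unfolding eq using B inner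
      by (auto simp: borel_iff restr(2) inner_regular_measure_def borel_sets_compactin[OF Haus]
          subset_trans intro!: SUP_cong)
  qed
  have outer': "outer_regular_measure ?S (restrict_space \<mu> V)"
  proof (rule outer_regular_measureI[OF restr(1)])
    fix B assume "B \<in> borel_sets ?S"
    then have B: "B \<in> borel_sets Y" "B \<subseteq> V"
      by (auto simp: borel_iff)
    have "(INF U\<in>{U. openin ?S U \<and> B \<subseteq> U}. emeasure (restrict_space \<mu> V) U) \<le> emeasure \<mu> U"
      if U: "openin Y U" "B \<subseteq> U" for U
    proof (rule INF_lower2[of "U \<inter> V"])
      have UV: "openin Y (U \<inter> V)"
        using U V by blast
      show "U \<inter> V \<in> {U. openin ?S U \<and> B \<subseteq> U}"
        using UV U B by (auto simp: openin_open_subtopology[OF V])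
      have "emeasure (restrict_space \<mu> V) (U \<inter> V) = emeasure \<mu> (U \<inter> V)"
        using UV by (simp add: restr(2) borel_sets_openin)
      also have "\<dots> \<le> emeasure \<mu> U"
        using U \<mu>_borel by (intro emeasure_mono) (auto simp: borel_measures_def borel_sets_openin)
      finally show "emeasure (restrict_space \<mu> V) (U \<inter> V) \<le> emeasure \<mu> U" .
    qed
    then have "(INF U\<in>{U. openin ?S U \<and> B \<subseteq> U}. emeasure (restrict_space \<mu> V) U) \<le> emeasure \<mu> B"
      using outer B by (auto simp: outer_regular_measure_def intro!: INF_greatest)
    then show "(INF U\<in>{U. openin ?S U \<and> B \<subseteq> U}. emeasure (restrict_space \<mu> V) U)
        \<le> emeasure (restrict_space \<mu> V) B"
      using B by (simp add: restr(2))
  qed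
  show ?thesis
    using restr inner' outer' compact
    by (auto simp: regular_borel_measures_def compactin_subtopology borel_sets_compactin[OF Haus])
qed

section \<open>Approximation of disjoint unions\<close>

text \<open>Compact \<open>K\<close> in \<open>A\<close> and \<open>L\<close> in \<open>B\<close>
  are disjoint, so the compact set \<open>K \<union> L\<close> has the sum of their measures. Adding
  suprema instead of using an epsilon also covers infinite measures.\<close>

lemma emeasure_Un_le_SUP_compactin:
  assumes Haus: "Hausdorff_space Y" and \<mu>: "\<mu> \<in> borel_measures Y"
    and A: "A \<in> borel_sets Y" "emeasure \<mu> A \<le> (SUP K\<in>{K. compactin Y K \<and> K \<subseteq> A}. emeasure \<mu> K)"
    and B: "B \<in> borel_sets Y" "emeasure \<mu> B \<le> (SUP K\<in>{K. compactin Y K \<and> K \<subseteq> B}. emeasure \<mu> K)"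
    and disj: "A \<inter> B = {}"
  shows "emeasure \<mu> (A \<union> B) \<le> (SUP K\<in>{K. compactin Y K \<and> K \<subseteq> A \<union> B}. emeasure \<mu> K)"
proof -
  let ?C = "\<lambda>B. {K. compactin Y K \<and> K \<subseteq> B}"
  \<comment> \<open>Moving a summand into a supremum in \<open>ennreal\<close> requires a nonempty
    index set; the empty compact set provides it.\<close>
  have ne: "?C D \<noteq> {}" for D
    using compactin_empty by blast
  have "emeasure \<mu> (A \<union> B) = emeasure \<mu> A + emeasure \<mu> B"
    using A B disj \<mu> by (intro plus_emeasure[symmetric]) (auto simp: borel_measures_def)
  also have "\<dots> \<le> (SUP K\<in>?C A. emeasure \<mu> K) + (SUP L\<in>?C B. emeasure \<mu> L)"
    using A B by (intro add_mono)
  also have "\<dots> = (SUP K\<in>?C A. SUP L\<in>?C B. emeasure \<mu> K + emeasure \<mu> L)"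
    by (subst ennreal_SUP_add_left[OF ne, symmetric], subst ennreal_SUP_add_right[OF ne]) (rule refl)
  also have "\<dots> \<le> (SUP K\<in>?C (A \<union> B). emeasure \<mu> K)"
  proof (intro SUP_least)
    fix K L assume KL: "K \<in> ?C A" "L \<in> ?C B"
    then have "emeasure \<mu> K + emeasure \<mu> L = emeasure \<mu> (K \<union> L)"
      using disj \<mu> by (intro plus_emeasure) (auto simp: borel_measures_def borel_sets_compactin[OF Haus])
    also have "\<dots> \<le> (SUP K\<in>?C (A \<union> B). emeasure \<mu> K)"
      using KL by (intro SUP_upper) (auto intro: compactin_Un)
    finally show "emeasure \<mu> K + emeasure \<mu> L \<le> (SUP K\<in>?C (A \<union> B). emeasure \<mu> K)" .
  qed
  finally show ?thesis .
qed

text \<open>The binary case gives the bound for the finite unions \<open>E N\<close> by induction,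
  and continuity from below passes to the limit. A compact subset of some \<open>E N\<close> is also
  one of the whole union.\<close>

lemma emeasure_UN_le_SUP_compactin:
  fixes D :: "nat \<Rightarrow> 'a set"
  assumes Haus: "Hausdorff_space Y" and \<mu>: "\<mu> \<in> borel_measures Y"
    and D: "\<And>n. D n \<in> borel_sets Y" and disj: "disjoint_family D"
    and le: "\<And>n. emeasure \<mu> (D n) \<le> (SUP K\<in>{K. compactin Y K \<and> K \<subseteq> D n}. emeasure \<mu> K)"
  shows "emeasure \<mu> (\<Union>n. D n) \<le> (SUP K\<in>{K. compactin Y K \<and> K \<subseteq> (\<Union>n. D n)}. emeasure \<mu> K)"
proof -
  interpret sigma_algebra "topspace Y" "borel_sets Y"
    by (rule sigma_algebra_borel_sets)
  define E where "E N = (\<Union>n<N. D n)" for N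
  have E_borel: "E N \<in> borel_sets Y" for N
    using D by (auto simp: E_def)
  have E_le: "emeasure \<mu> (E N) \<le> (SUP K\<in>{K. compactin Y K \<and> K \<subseteq> E N}. emeasure \<mu> K)" for N
  proof (induction N)
    case 0
    then show ?case by (simp add: E_def)
  next
    case (Suc N)
    have "E (Suc N) = E N \<union> D N"
      by (auto simp: E_def less_Suc_eq)
    moreover have "D n \<inter> D N = {}" if "n < N" for n
      using disj that by (intro disjoint_family_onD) auto
    then have "E N \<inter> D N = {}"
      by (auto simp: E_def)
    ultimately show ?case
      using emeasure_Un_le_SUP_compactin[OF Haus \<mu> E_borel Suc D le] by simp
  qed
  have UN: "(\<Union>N. E N) = (\<Union>n. D n)"
    by (auto simp: E_def)
  have "emeasure \<mu> (\<Union>n. D n) = (SUP N. emeasure \<mu> (E N))"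
    using E_borel \<mu> unfolding UN[symmetric]
    by (intro SUP_emeasure_incseq[symmetric])
      (auto simp: borel_measures_def incseq_def E_def dest: less_le_trans)
  also have "\<dots> \<le> (SUP K\<in>{K. compactin Y K \<and> K \<subseteq> (\<Union>n. D n)}. emeasure \<mu> K)"
    unfolding UN[symmetric]
    by (intro SUP_least order_trans[OF E_le] SUP_subset_mono) auto
  finally show ?thesis .
qed

text \<open>Each \<open>D n\<close> is enclosed in an open set with a geometrically decreasing
  error. The union of these sets is open, and countable subadditivity bounds its measure.\<close>

lemma INF_openin_UN_le_emeasure:
  fixes D :: "nat \<Rightarrow> 'a set"
  assumes \<mu>: "\<mu> \<in> borel_measures Y"
    and D: "\<And>n. D n \<in> borel_sets Y" and disj: "disjoint_family D"
    and le: "\<And>n. (INF U\<in>{U. openin Y U \<and> D n \<subseteq> U}. emeasure \<mu> U) \<le> emeasure \<mu> (D n)"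
  shows "(INF U\<in>{U. openin Y U \<and> (\<Union>n. D n) \<subseteq> U}. emeasure \<mu> U) \<le> emeasure \<mu> (\<Union>n. D n)"
proof (rule ennreal_le_epsilon)
  fix e :: real
  assume fin: "emeasure \<mu> (\<Union>n. D n) < top" and e: "0 < e"
  have sets: "sets \<mu> = borel_sets Y"
    using \<mu> by (simp add: borel_measures_def)
  have "\<exists>U. openin Y U \<and> D n \<subseteq> U \<and> emeasure \<mu> U \<le> emeasure \<mu> (D n) + e * (1/2) ^ Suc n" for n
  proof -
    have "emeasure \<mu> (D n) \<le> emeasure \<mu> (\<Union>n. D n)"
      using D by (intro emeasure_mono sets.countable_UN) (auto simp: sets)
    then have "emeasure \<mu> (D n) < top"
      using fin by (rule le_less_trans)
    \<comment> \<open>Adding a positive error is a strict increase only at finite values. Finiteness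
      comes from \<open>ennreal_le_epsilon\<close>, which lets the measure of the union be assumed
      finite.\<close>
    then have "emeasure \<mu> (D n) + 0 < emeasure \<mu> (D n) + ennreal (e * (1/2) ^ Suc n)"
      using e by (subst ennreal_add_left_cancel_less) (auto simp: ennreal_zero_less_mult_iff)
    then have "(INF U\<in>{U. openin Y U \<and> D n \<subseteq> U}. emeasure \<mu> U)
        < emeasure \<mu> (D n) + ennreal (e * (1/2) ^ Suc n)"
      using le[of n] by (simp add: le_less_trans)
    then show ?thesis
      unfolding INF_less_iff by (auto intro: less_imp_le)
  qed
  then obtain U where U: "\<And>n. openin Y (U n)" "\<And>n. D n \<subseteq> U n"
    and U_le: "\<And>n. emeasure \<mu> (U n) \<le> emeasure \<mu> (D n) + e * (1/2) ^ Suc n"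
    by metis
  have "(INF U\<in>{U. openin Y U \<and> (\<Union>n. D n) \<subseteq> U}. emeasure \<mu> U) \<le> emeasure \<mu> (\<Union>n. U n)"
    using U by (intro INF_lower) blast
  also have "\<dots> \<le> (\<Sum>n. emeasure \<mu> (U n))"
    using U by (intro emeasure_subadditive_countably) (auto simp: sets borel_sets_openin)
  also have "\<dots> \<le> (\<Sum>n. emeasure \<mu> (D n) + e * (1/2) ^ Suc n)"
    using U_le by (intro suminf_le) auto
  also have "\<dots> = (\<Sum>n. emeasure \<mu> (D n)) + (\<Sum>n. ennreal e * ennreal ((1/2) ^ Suc n))"
    using e by (subst suminf_add[symmetric])
      (auto simp del: ennreal_suminf_cmult simp add: ennreal_mult[symmetric])
  \<comment> \<open>The exponent \<open>Suc n\<close> makes the half powers sum to 1, so the total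
    error is exactly \<open>e\<close>.\<close>
  also have "\<dots> = (\<Sum>n. emeasure \<mu> (D n)) + e"
    unfolding ennreal_suminf_cmult
    by (subst suminf_ennreal_eq[OF zero_le_power power_half_series]) auto
  also have "(\<Sum>n. emeasure \<mu> (D n)) = emeasure \<mu> (\<Union>n. D n)"
    using D disj by (intro suminf_emeasure) (auto simp: sets)
  finally show "(INF U\<in>{U. openin Y U \<and> (\<Union>n. D n) \<subseteq> U}. emeasure \<mu> U)
      \<le> emeasure \<mu> (\<Union>n. D n) + e" .
qed

section \<open>Cutting Borel sets along a countable open cover\<close>

lemma disjointed_in_borel_sets:
  fixes A :: "nat \<Rightarrow> 'a set"
  assumes "\<And>n. A n \<in> borel_sets Y"
  shows "disjointed A n \<in> borel_sets Y"
proof -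
  interpret sigma_algebra "topspace Y" "borel_sets Y"
    by (rule sigma_algebra_borel_sets)
  show ?thesis
    using range_disjointed_sets[of A] assms by auto
qed

lemma borel_sets_disjointed_cover:
  fixes A :: "nat \<Rightarrow> 'a set"
  assumes A: "\<And>n. openin Y (A n)" "(\<Union>n. A n) = topspace Y" and B: "B \<in> borel_sets Y"
  shows "(\<Union>n. B \<inter> disjointed A n) = B" and "disjoint_family (\<lambda>n. B \<inter> disjointed A n)"
    and "B \<inter> disjointed A n \<in> borel_sets Y" and "B \<inter> disjointed A n \<subseteq> A n"
proof -
  interpret sigma_algebra "topspace Y" "borel_sets Y"
    by (rule sigma_algebra_borel_sets)
  show "B \<inter> disjointed A n \<in> borel_sets Y" and "B \<inter> disjointed A n \<subseteq> A n"
    using A B disjointed_in_borel_sets[of A Y n] disjointed_subset[of A n]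
    by (auto simp: borel_sets_openin)
  show "(\<Union>n. B \<inter> disjointed A n) = B"
    using A sets_into_space[OF B] UN_disjointed_eq[of A] by auto
  show "disjoint_family (\<lambda>n. B \<inter> disjointed A n)"
    using disjoint_family_disjointed[of A] unfolding disjoint_family_on_def by blast
qed

text \<open>Countable additivity over the pieces of \<open>B\<close>. As each piece lies in one
  \<open>A n\<close>, the right-hand side depends only on the restrictions of \<open>\<mu>\<close>
  to the cover.\<close>

lemma emeasure_disjointed_cover:
  fixes A :: "nat \<Rightarrow> 'a set"
  assumes A: "\<And>n. openin Y (A n)" "(\<Union>n. A n) = topspace Y"
    and \<mu>: "\<mu> \<in> borel_measures Y" and B: "B \<in> borel_sets Y"
  shows "emeasure \<mu> B = (\<Sum>n. emeasure \<mu> (B \<inter> disjointed A n))"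
  using suminf_emeasure[of "\<lambda>n. B \<inter> disjointed A n" \<mu>] \<mu>
    borel_sets_disjointed_cover[of Y A B, OF A B]
  by (simp add: borel_measures_def image_subset_iff)

section \<open>Regularity is local\<close>

text \<open>A Borel set inside one \<open>A n\<close> takes both approximations from the
  restriction, since compact and open sets of the open subspace \<open>A n\<close> are compact and
  open in \<open>Y\<close>. The two union lemmas then treat the pieces of an arbitrary Borel
  set.\<close>

lemma regular_borel_measures_locally_regular:
  fixes A :: "nat \<Rightarrow> 'a set"
  assumes Haus: "Hausdorff_space Y" and loc: "locally_compact_space Y"
    and \<mu>: "\<mu> \<in> borel_measures Y"
    and A: "\<And>n. openin Y (A n)" "(\<Union>n. A n) = topspace Y"
    and reg: "\<And>n. restrict_space \<mu> (A n) \<in> regular_borel_measures (subtopology Y (A n))"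
  shows "\<mu> \<in> regular_borel_measures Y"
proof -
  have sets: "sets \<mu> = borel_sets Y"
    using \<mu> by (simp add: borel_measures_def)
  note emeasure_restr = borel_measures_restrict_space(2)[OF \<mu> A(1)]
  have inner_le: "emeasure \<mu> B \<le> (SUP K\<in>{K. compactin Y K \<and> K \<subseteq> B}. emeasure \<mu> K)"
    and outer_le: "(INF U\<in>{U. openin Y U \<and> B \<subseteq> U}. emeasure \<mu> U) \<le> emeasure \<mu> B"
    if B: "B \<in> borel_sets Y" "B \<subseteq> A n" for B n
  proof -
    have B': "B \<in> borel_sets (subtopology Y (A n))"
      using B A by (simp add: borel_sets_open_subtopology_iff)
    have "emeasure \<mu> B = emeasure (restrict_space \<mu> (A n)) B"
      using B by (simp add: emeasure_restr)
    also have "\<dots> = (SUP K\<in>{K. compactin (subtopology Y (A n)) K \<and> K \<subseteq> B}.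
        emeasure (restrict_space \<mu> (A n)) K)"
      using reg B' by (simp add: regular_borel_measures_def inner_regular_measure_def)
    also have "\<dots> \<le> (SUP K\<in>{K. compactin Y K \<and> K \<subseteq> B}. emeasure \<mu> K)"
      by (intro SUP_mono) (auto simp: compactin_subtopology emeasure_restr borel_sets_compactin[OF Haus])
    finally show "emeasure \<mu> B \<le> (SUP K\<in>{K. compactin Y K \<and> K \<subseteq> B}. emeasure \<mu> K)" .
    have "(INF U\<in>{U. openin Y U \<and> B \<subseteq> U}. emeasure \<mu> U) \<le>
        (INF U\<in>{U. openin (subtopology Y (A n)) U \<and> B \<subseteq> U}. emeasure (restrict_space \<mu> (A n)) U)"
      by (intro INF_mono)
        (auto simp: openin_open_subtopology[OF A(1)] emeasure_restr borel_sets_openin)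
    also have "\<dots> = emeasure (restrict_space \<mu> (A n)) B"
      using reg B' by (simp add: regular_borel_measures_def outer_regular_measure_def)
    also have "\<dots> = emeasure \<mu> B"
      using B by (simp add: emeasure_restr)
    finally show "(INF U\<in>{U. openin Y U \<and> B \<subseteq> U}. emeasure \<mu> U) \<le> emeasure \<mu> B" .
  qed
  note split = borel_sets_disjointed_cover[of Y A, OF A]
  have inner: "inner_regular_measure Y \<mu>"
  proof (rule inner_regular_measureI[OF \<mu>])
    fix B assume B: "B \<in> borel_sets Y"
    show "emeasure \<mu> B \<le> (SUP K\<in>{K. compactin Y K \<and> K \<subseteq> B}. emeasure \<mu> K)"
      using emeasure_UN_le_SUP_compactin[OF Haus \<mu> split(3,2)[OF B] inner_le[OF split(3,4)[OF B]]]
      unfolding split(1)[OF B] .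
  qed
  have outer: "outer_regular_measure Y \<mu>"
  proof (rule outer_regular_measureI[OF \<mu>])
    fix B assume B: "B \<in> borel_sets Y"
    show "(INF U\<in>{U. openin Y U \<and> B \<subseteq> U}. emeasure \<mu> U) \<le> emeasure \<mu> B"
      using INF_openin_UN_le_emeasure[OF \<mu> split(3,2)[OF B] outer_le[OF split(3,4)[OF B]]]
      unfolding split(1)[OF B] .
  qed
  have "emeasure \<mu> K < \<infinity>" if K: "compactin Y K" for K
  proof -
    \<comment> \<open>Open sets of finite measure: once they cover \<open>K\<close>, a finite
      subfamily bounds its measure.\<close>
    define \<V> where "\<V> = {V. openin Y V \<and> emeasure \<mu> V < \<infinity>}"
    have "K \<subseteq> \<Union>\<V>"
    proof
      fix x assume "x \<in> K"
      then obtain n where "x \<in> A n"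
        using K A(2) compactin_subset_topspace by blast
      \<comment> \<open>In a locally compact Hausdorff space compact neighbourhoods form a base, so
        \<open>C\<close> fits inside \<open>A n\<close>. There it is compact, and regularity of the
        restriction makes its measure finite.\<close>
      then obtain V C where VC: "openin Y V" "compactin Y C" "x \<in> V" "V \<subseteq> C" "C \<subseteq> A n"
        using loc A(1)[of n] locally_compact_space_neighbourhood_base[of Y] Haus
        by (metis neighbourhood_base_of)
      have "emeasure \<mu> V \<le> emeasure \<mu> C"
        using VC by (intro emeasure_mono) (auto simp: sets borel_sets_compactin[OF Haus])
      also have "\<dots> = emeasure (restrict_space \<mu> (A n)) C"
        using VC by (simp add: emeasure_restr borel_sets_compactin[OF Haus])
      also have "\<dots> < \<infinity>"
        using reg[of n] VC by (simp add: regular_borel_measures_def compactin_subtopology)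
      finally show "x \<in> \<Union>\<V>"
        using VC by (auto simp: \<V>_def)
    qed
    then obtain \<F> where \<F>: "finite \<F>" "\<F> \<subseteq> \<V>" "K \<subseteq> \<Union>\<F>"
      using compactinD[OF K, of \<V>] by (auto simp: \<V>_def)
    have \<F>_sets: "\<F> \<subseteq> sets \<mu>"
      using \<F> by (auto simp: \<V>_def sets borel_sets_openin)
    have "emeasure \<mu> K \<le> emeasure \<mu> (\<Union>\<F>)"
      using \<F> \<F>_sets by (intro emeasure_mono sets.finite_Union) auto
    also have "\<dots> \<le> (\<Sum>V\<in>\<F>. emeasure \<mu> V)"
      using emeasure_subadditive_finite[of \<F> "\<lambda>V. V" \<mu>] \<F> \<F>_sets by simp
    also have "\<dots> < \<infinity>"
      using \<F> by (auto simp: \<V>_def)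
    finally show ?thesis .
  qed
  with inner outer \<mu> show ?thesis
    by (simp add: regular_borel_measures_def)
qed

section \<open>Locality and gluing for sequences of open sets\<close>

text \<open>\<open>W\<close> is second countable, hence Lindelof, and a countable subcover can be
  enumerated with repetitions. A sequence needs at least one member to take as value, so the empty
  cover is treated separately.\<close>

lemma open_cover_sequence:
  assumes sc: "second_countable X" and W: "openin X W" and cover: "open_cover X W \<U>" and "\<U> \<noteq> {}"
  obtains A :: "nat \<Rightarrow> 'a set" where "\<And>n. A n \<in> \<U>" and "(\<Union>n. A n) = W"
proof -
  have lind: "Lindelof_space (subtopology X W)"
    using sc by (intro second_countable_imp_Lindelof_space second_countable_subtopology)
  have op: "\<forall>U\<in>\<U>. openin X U" and sub: "W \<subseteq> \<Union>\<U>"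
    using cover by (auto simp: open_cover_def)
  obtain \<V> where \<V>: "countable \<V>" "\<V> \<subseteq> \<U>" "W \<subseteq> \<Union>\<V>"
    using lind[unfolded Lindelof_space_subtopology_subset[OF openin_subset[OF W]],
        rule_format, OF conjI[OF op sub]] by auto
  obtain U where "U \<in> \<U>"
    using \<open>\<U> \<noteq> {}\<close> by blast
  \<comment> \<open>The countable subcover may be empty when \<open>W\<close> is; adding one member
    of the cover makes \<open>from_nat_into\<close> an enumeration.\<close>
  let ?\<V> = "insert U \<V>"
  have range: "range (from_nat_into ?\<V>) = ?\<V>"
    using \<V> by (intro range_from_nat_into) auto
  have "?\<V> \<subseteq> \<U>"
    using \<V> \<open>U \<in> \<U>\<close> by blast
  moreover have "\<Union>?\<V> = W"
    using \<V> \<open>?\<V> \<subseteq> \<U>\<close> cover by (auto simp: open_cover_def)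
  ultimately have "(\<Union>n. from_nat_into ?\<V> n) = W"
    using range by metis
  moreover have "from_nat_into ?\<V> n \<in> \<U>" for n
    using from_nat_into[of ?\<V> n] \<open>?\<V> \<subseteq> \<U>\<close> by auto
  ultimately show ?thesis
    by (intro that)
qed

text \<open>The outer sum is an integral against counting measure, which commutes with countable
  sums of nonnegative functions.\<close>

lemma suminf_commute_ennreal:
  fixes f :: "nat \<Rightarrow> nat \<Rightarrow> ennreal"
  shows "(\<Sum>i. \<Sum>j. f i j) = (\<Sum>j. \<Sum>i. f i j)"
proof -
  have "(\<Sum>i. \<Sum>j. f i j) = (\<integral>\<^sup>+i. (\<Sum>j. f i j) \<partial>count_space UNIV)"
    by (rule nn_integral_count_space_nat[symmetric])
  also have "\<dots> = (\<Sum>j. \<integral>\<^sup>+i. f i j \<partial>count_space UNIV)"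
    by (rule nn_integral_suminf) simp
  also have "\<dots> = (\<Sum>j. \<Sum>i. f i j)"
    by (simp add: nn_integral_count_space_nat)
  finally show ?thesis .
qed

lemma borel_measures_locality:
  fixes A :: "nat \<Rightarrow> 'a set"
  assumes \<mu>: "\<mu> \<in> borel_measures Y" and \<nu>: "\<nu> \<in> borel_measures Y"
    and A: "\<And>n. openin Y (A n)" "(\<Union>n. A n) = topspace Y"
    and eq: "\<And>n. restrict_space \<mu> (A n) = restrict_space \<nu> (A n)"
  shows "\<mu> = \<nu>"
proof (rule borel_measures_eqI[OF \<mu> \<nu>])
  fix B assume B: "B \<in> borel_sets Y"
  note D = borel_sets_disjointed_cover(3,4)[of Y A, OF A B]
  have "emeasure \<mu> (B \<inter> disjointed A n) = emeasure \<nu> (B \<inter> disjointed A n)" for n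
    using borel_measures_restrict_space(2)[OF \<mu> A(1) D]
      borel_measures_restrict_space(2)[OF \<nu> A(1) D] by (simp add: eq)
  then show "emeasure \<mu> B = emeasure \<nu> B"
    by (simp add: emeasure_disjointed_cover[of Y A, OF A \<mu> B]
        emeasure_disjointed_cover[of Y A, OF A \<nu> B])
qed

text \<open>By \<open>emeasure_disjointed_cover\<close> this sum is the only value a glued measure
  can have. Agreement with a compatible family is checked later, in
  \<open>measure_sections_gluing\<close>.\<close>

lemma borel_measures_gluing:
  fixes A :: "nat \<Rightarrow> 'a set" and \<sigma> :: "nat \<Rightarrow> 'a measure"
  assumes A: "\<And>n. openin Y (A n)" "(\<Union>n. A n) = topspace Y"
    and \<sigma>: "\<And>n. \<sigma> n \<in> borel_measures (subtopology Y (A n))"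
  obtains \<mu> where "\<mu> \<in> borel_measures Y"
    and "\<And>B. B \<in> borel_sets Y \<Longrightarrow> emeasure \<mu> B = (\<Sum>n. emeasure (\<sigma> n) (B \<inter> disjointed A n))"
proof -
  interpret sigma_algebra "topspace Y" "borel_sets Y"
    by (rule sigma_algebra_borel_sets)
  define f where "f B = (\<Sum>n. emeasure (\<sigma> n) (B \<inter> disjointed A n))" for B
  have sets: "B \<inter> disjointed A n \<in> sets (\<sigma> n)" if "B \<in> borel_sets Y" for B n
    using that A \<sigma>[of n] disjointed_in_borel_sets[of A Y n] disjointed_subset[of A n]
    by (auto simp: borel_measures_def borel_sets_open_subtopology_iff borel_sets_openin)
  have add: "countably_additive (borel_sets Y) f"
    unfolding countably_additive_def
  proof (intro allI impI)
    fix B :: "nat \<Rightarrow> 'a set"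
    assume B: "range B \<subseteq> borel_sets Y" "disjoint_family B"
    \<comment> \<open>Interchanging the sums reduces additivity of \<open>f\<close> to that of each
      \<open>\<sigma> n\<close>.\<close>
    have "(\<Sum>i. f (B i)) = (\<Sum>n. \<Sum>i. emeasure (\<sigma> n) (B i \<inter> disjointed A n))"
      unfolding f_def by (rule suminf_commute_ennreal)
    also have "\<dots> = (\<Sum>n. emeasure (\<sigma> n) (\<Union>i. B i \<inter> disjointed A n))"
      using B sets by (intro suminf_cong suminf_emeasure) (auto simp: disjoint_family_on_def)
    also have "\<dots> = f (\<Union>i. B i)"
      by (simp add: f_def)
    finally show "(\<Sum>i. f (B i)) = f (\<Union>i. B i)" .
  qed
  let ?\<mu> = "measure_of (topspace Y) (borel_sets Y) f"
  show ?thesis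
  proof
    show "?\<mu> \<in> borel_measures Y"
      by (simp add: borel_measures_def)
    show "emeasure ?\<mu> B = (\<Sum>n. emeasure (\<sigma> n) (B \<inter> disjointed A n))" if "B \<in> borel_sets Y" for B
      using that add
      by (subst emeasure_measure_of_sigma) (auto simp: positive_def f_def intro: sigma_algebra_axioms)
  qed
qed

text \<open>Serves the empty cover, whose union is empty: the only Borel set is then the empty set,
  where every measure vanishes.\<close>

lemma borel_measures_topspace_empty:
  assumes "topspace Y = {}" and \<mu>: "\<mu> \<in> borel_measures Y" and \<nu>: "\<nu> \<in> borel_measures Y"
  shows "\<mu> = \<nu>"
proof (rule borel_measures_eqI[OF \<mu> \<nu>])
  interpret sigma_algebra "topspace Y" "borel_sets Y"
    by (rule sigma_algebra_borel_sets)
  show "emeasure \<mu> B = emeasure \<nu> B" if "B \<in> borel_sets Y" for B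
    using sets_into_space[OF that] assms(1) by simp
qed

lemma regular_borel_measures_topspace_empty:
  assumes "topspace Y = {}" and \<mu>: "\<mu> \<in> borel_measures Y"
  shows "\<mu> \<in> regular_borel_measures Y"
proof -
  interpret sigma_algebra "topspace Y" "borel_sets Y"
    by (rule sigma_algebra_borel_sets)
  have B: "B = {}" if "B \<in> borel_sets Y" for B
    using sets_into_space[OF that] assms(1) by simp
  have "inner_regular_measure Y \<mu>"
    by (rule inner_regular_measureI[OF \<mu>]) (auto dest!: B)
  moreover have "outer_regular_measure Y \<mu>"
    by (rule outer_regular_measureI[OF \<mu>]) (auto dest!: B intro: INF_lower2[of "{}"])
  moreover have "emeasure \<mu> K < \<infinity>" if "compactin Y K" for K
    using compactin_subset_topspace[OF that] assms(1) by simp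
  ultimately show ?thesis
    using \<mu> by (simp add: regular_borel_measures_def)
qed

section \<open>The sheaf of Borel measures\<close>

lemma emeasure_measure_restriction:
  assumes "\<mu> \<in> measure_sections X U" and "openin X U" and "openin X V" and "V \<subseteq> U"
    and "B \<in> borel_sets X" and "B \<subseteq> V"
  shows "emeasure (measure_restriction U V \<mu>) B = emeasure \<mu> B"
  using assms by (simp add: measure_restriction borel_sets_open_subtopology_iff)

lemma measure_sections_eqI:
  assumes "openin X U" and "\<mu> \<in> measure_sections X U" and "\<nu> \<in> measure_sections X U"
    and "\<And>B. B \<in> borel_sets X \<Longrightarrow> B \<subseteq> U \<Longrightarrow> emeasure \<mu> B = emeasure \<nu> B"
  shows "\<mu> = \<nu>"
  using assms
  by (auto simp: measure_sections_def borel_sets_open_subtopology_iff intro: borel_measures_eqI)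

text \<open>Restriction never changes the value at a Borel set inside the smaller open set, so both
  functor laws hold by comparing values.\<close>

lemma presheaf_measure_sections: "presheaf X (measure_sections X) measure_restriction"
  unfolding presheaf_def
proof (intro conjI allI impI ballI)
  show "measure_restriction U V \<mu> \<in> measure_sections X V"
    if "openin X U" "openin X V" "V \<subseteq> U" "\<mu> \<in> measure_sections X U" for U V \<mu>
    using that by (intro measure_restriction)
  show "measure_restriction U U \<mu> = \<mu>"
    if "openin X U" "\<mu> \<in> measure_sections X U" for U \<mu>
    using that
    by (intro measure_sections_eqI[of X U]) (simp_all add: measure_restriction emeasure_measure_restriction)
  show "measure_restriction V W (measure_restriction U V \<mu>) = measure_restriction U W \<mu>"
    if "openin X U" "openin X V" "openin X W" "W \<subseteq> V" "V \<subseteq> U" "\<mu> \<in> measure_sections X U"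
    for U V W \<mu>
    using that
    by (intro measure_sections_eqI[of X W])
      (simp_all add: measure_restriction(1)[of _ X] emeasure_measure_restriction[of _ X]
        subset_trans[of W V U] subset_trans[of _ W V])
qed

text \<open>Turns a sequence from a cover of \<open>W\<close> into an open cover of the space
  \<open>subtopology X W\<close>, the form that the lemmas about a single space \<open>Y\<close>
  expect.\<close>

lemma open_cover_subtopology_sequence:
  assumes "openin X W" and "open_cover X W \<U>"
    and A: "\<And>n::nat. A n \<in> \<U>" "(\<Union>n. A n) = W"
  shows "openin (subtopology X W) (A n)" and "(\<Union>n. A n) = topspace (subtopology X W)"
    and "subtopology (subtopology X W) (A n) = subtopology X (A n)"
    and "openin X (A n)" and "A n \<subseteq> W"
proof -
  show sub: "A n \<subseteq> W"
    using A(2) by blast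
  show op: "openin X (A n)"
    using assms(2) A(1) by (simp add: open_cover_def)
  show "openin (subtopology X W) (A n)"
    using op sub assms(1) by (simp add: openin_open_subtopology)
  show "(\<Union>n. A n) = topspace (subtopology X W)"
    using A(2) openin_subset[OF assms(1)] by (simp add: inf.absorb2)
  show "subtopology (subtopology X W) (A n) = subtopology X (A n)"
    using sub by (simp add: subtopology_subtopology inf.absorb2)
qed

lemma measure_sections_locality:
  assumes sc: "second_countable X" and W: "openin X W" and cover: "open_cover X W \<U>"
    and \<mu>: "\<mu> \<in> measure_sections X W" and \<nu>: "\<nu> \<in> measure_sections X W"
    and eq: "\<And>U. U \<in> \<U> \<Longrightarrow> measure_restriction W U \<mu> = measure_restriction W U \<nu>"
  shows "\<mu> = \<nu>"
proof (cases "\<U> = {}")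
  case True
  then have "topspace (subtopology X W) = {}"
    using cover by (simp add: open_cover_def)
  then show ?thesis
    using \<mu> \<nu> unfolding measure_sections_def by (rule borel_measures_topspace_empty)
next
  case False
  obtain A :: "nat \<Rightarrow> 'a set" where A: "\<And>n. A n \<in> \<U>" "(\<Union>n. A n) = W"
    by (rule open_cover_sequence[OF sc W cover False]) blast
  then show ?thesis
    using \<mu> \<nu> eq open_cover_subtopology_sequence(1,2)[OF W cover A]
    by (intro borel_measures_locality[of \<mu> "subtopology X W" \<nu> A])
      (auto simp: measure_sections_def measure_restriction_def)
qed

text \<open>The measure is glued along a sequence \<open>A n\<close> only, but must restrict
  correctly to every member \<open>U\<close> of the cover. The pieces of a Borel set in
  \<open>U\<close> lie in \<open>A n \<inter> U\<close>, where compatibility replaces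
  \<open>\<sigma> (A n)\<close> by \<open>\<sigma> U\<close>; the sum then collapses by additivity
  of \<open>\<sigma> U\<close>.\<close>

lemma measure_sections_gluing:
  assumes sc: "second_countable X" and W: "openin X W" and cover: "open_cover X W \<U>"
    and \<sigma>: "\<And>U. U \<in> \<U> \<Longrightarrow> \<sigma> U \<in> measure_sections X U"
    and compat: "\<And>U V. U \<in> \<U> \<Longrightarrow> V \<in> \<U> \<Longrightarrow>
      measure_restriction U (U \<inter> V) (\<sigma> U) = measure_restriction V (U \<inter> V) (\<sigma> V)"
  shows "\<exists>\<mu>\<in>measure_sections X W. \<forall>U\<in>\<U>. measure_restriction W U \<mu> = \<sigma> U"
proof (cases "\<U> = {}")
  case True
  \<comment> \<open>For the empty cover any section over \<open>W\<close> satisfies the gluing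
    condition vacuously; the zero measure is a choice.\<close>
  have "null_measure (sigma W (borel_sets (subtopology X W))) \<in> measure_sections X W"
    using sigma_algebra_borel_sets[of "subtopology X W"] openin_subset[OF W]
    by (simp add: measure_sections_def borel_measures_def inf.absorb2 sigma_algebra.sets_measure_of_eq
        sigma_algebra.space_measure_of_eq)
  with True show ?thesis by blast
next
  case False
  obtain A :: "nat \<Rightarrow> 'a set" where A: "\<And>n. A n \<in> \<U>" "(\<Union>n. A n) = W"
    by (rule open_cover_sequence[OF sc W cover False]) blast
  note Y = open_cover_subtopology_sequence[OF W cover A]
  have "\<sigma> (A n) \<in> borel_measures (subtopology (subtopology X W) (A n))" for n
    using \<sigma>[OF A(1)] by (simp add: Y(3) measure_sections_def)
  from borel_measures_gluing[of _ A "\<lambda>n. \<sigma> (A n)", OF Y(1,2) this]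
  obtain \<mu> where \<mu>: "\<mu> \<in> borel_measures (subtopology X W)" and emeasure_\<mu>:
    "\<And>B. B \<in> borel_sets (subtopology X W) \<Longrightarrow>
      emeasure \<mu> B = (\<Sum>n. emeasure (\<sigma> (A n)) (B \<inter> disjointed A n))"
    by blast
  have \<mu>_sect: "\<mu> \<in> measure_sections X W"
    using \<mu> by (simp add: measure_sections_def)
  have "measure_restriction W U \<mu> = \<sigma> U" if U: "U \<in> \<U>" for U
  proof -
    have U': "openin X U" "U \<subseteq> W"
      using U cover by (auto simp: open_cover_def)
    show ?thesis
    proof (rule measure_sections_eqI[OF U'(1) _ \<sigma>[OF U]])
      show "measure_restriction W U \<mu> \<in> measure_sections X U"
        using \<mu>_sect W U' by (rule measure_restriction)
      fix B assume B: "B \<in> borel_sets X" "B \<subseteq> U"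
      have BW: "B \<in> borel_sets (subtopology X W)"
        using B U' by (auto simp: borel_sets_open_subtopology_iff[OF W])
      have "emeasure (\<sigma> (A n)) (B \<inter> disjointed A n) = emeasure (\<sigma> U) (B \<inter> disjointed A n)" for n
      proof -
        let ?D = "B \<inter> disjointed A n"
        have D: "?D \<in> borel_sets X" "?D \<subseteq> A n \<inter> U"
          using borel_sets_disjointed_cover(3,4)[of _ A, OF Y(1,2) BW] B(2)
          by (auto simp: borel_sets_open_subtopology_iff[OF W])
        have op: "openin X (A n \<inter> U)"
          using Y(4) U' by blast
        have "emeasure (\<sigma> (A n)) ?D = emeasure (measure_restriction (A n) (A n \<inter> U) (\<sigma> (A n))) ?D"
          using emeasure_measure_restriction[OF \<sigma>[OF A(1)] Y(4) op _ D] by simp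
        also have "\<dots> = emeasure (\<sigma> U) ?D"
          using emeasure_measure_restriction[OF \<sigma>[OF U] U'(1) op _ D] compat[OF A(1) U] by simp
        finally show ?thesis .
      qed
      then have "emeasure \<mu> B = (\<Sum>n. emeasure (\<sigma> U) (B \<inter> disjointed A n))"
        by (simp add: emeasure_\<mu>[OF BW])
      also have "\<dots> = emeasure (\<sigma> U) (\<Union>n. B \<inter> disjointed A n)"
      proof (rule suminf_emeasure)
        show "range (\<lambda>n. B \<inter> disjointed A n) \<subseteq> sets (\<sigma> U)"
          using borel_sets_disjointed_cover(3)[of _ A, OF Y(1,2) BW] B(2) \<sigma>[OF U]
          by (auto simp: measure_sections_def borel_measures_def borel_sets_open_subtopology_iff[OF W]
              borel_sets_open_subtopology_iff[OF U'(1)])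
        show "disjoint_family (\<lambda>n. B \<inter> disjointed A n)"
          by (rule borel_sets_disjointed_cover(2)[of _ A, OF Y(1,2) BW])
      qed
      also have "\<dots> = emeasure (\<sigma> U) B"
        by (simp only: borel_sets_disjointed_cover(1)[of _ A, OF Y(1,2) BW])
      finally show "emeasure (measure_restriction W U \<mu>) B = emeasure (\<sigma> U) B"
        using emeasure_measure_restriction[OF \<mu>_sect W U' B] by simp
    qed
  qed
  with \<mu>_sect show ?thesis by blast
qed

lemma sheaf_measure_sections:
  assumes "second_countable X"
  shows "sheaf X (measure_sections X) measure_restriction"
  unfolding sheaf_def
proof (intro conjI allI impI ballI presheaf_measure_sections)
  show "\<mu> = \<nu>"
    if "openin X W" "open_cover X W \<U>" "\<mu> \<in> measure_sections X W" "\<nu> \<in> measure_sections X W"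
      "\<forall>U\<in>\<U>. measure_restriction W U \<mu> = measure_restriction W U \<nu>" for W \<U> \<mu> \<nu>
    using measure_sections_locality[OF assms that(1-4)] that(5) by blast
  show "\<exists>\<mu>\<in>measure_sections X W. \<forall>U\<in>\<U>. measure_restriction W U \<mu> = \<sigma> U"
    if "openin X W" "open_cover X W \<U>" "\<forall>U\<in>\<U>. \<sigma> U \<in> measure_sections X U"
      "\<forall>U\<in>\<U>. \<forall>V\<in>\<U>.
        measure_restriction U (U \<inter> V) (\<sigma> U) = measure_restriction V (U \<inter> V) (\<sigma> V)" for W \<U> \<sigma>
    using that by (intro measure_sections_gluing[OF assms]) auto
qed

section \<open>The sub-sheaf of regular Borel measures\<close>

lemma regular_measure_sections_subset: "regular_measure_sections X U \<subseteq> measure_sections X U"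
  by (auto simp: regular_measure_sections_def regular_borel_measures_def measure_sections_def)

lemma regular_measure_sections_restriction:
  assumes "Hausdorff_space X" and "openin X U" and "openin X V" and "V \<subseteq> U"
    and "\<mu> \<in> regular_measure_sections X U"
  shows "measure_restriction U V \<mu> \<in> regular_measure_sections X V"
proof -
  have "openin (subtopology X U) V" and "subtopology (subtopology X U) V = subtopology X V"
    using assms by (auto simp: openin_open_subtopology subtopology_subtopology inf.absorb2)
  then show ?thesis
    using regular_borel_measures_restrict_space[of \<mu> "subtopology X U" V] assms
    by (simp add: regular_measure_sections_def measure_restriction_def Hausdorff_space_subtopology)
qed

lemma regular_measure_sections_local:
  assumes sc: "second_countable X" and loc: "locally_compact_space X" and Haus: "Hausdorff_space X"
    and W: "openin X W" and cover: "open_cover X W \<U>" and \<mu>: "\<mu> \<in> measure_sections X W"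
    and reg: "\<And>U. U \<in> \<U> \<Longrightarrow> measure_restriction W U \<mu> \<in> regular_measure_sections X U"
  shows "\<mu> \<in> regular_measure_sections X W"
proof (cases "\<U> = {}")
  case True
  then have "topspace (subtopology X W) = {}"
    using cover by (simp add: open_cover_def)
  then show ?thesis
    using \<mu> unfolding regular_measure_sections_def measure_sections_def
    by (rule regular_borel_measures_topspace_empty)
next
  case False
  obtain A :: "nat \<Rightarrow> 'a set" where A: "\<And>n. A n \<in> \<U>" "(\<Union>n. A n) = W"
    by (rule open_cover_sequence[OF sc W cover False]) blast
  note Y = open_cover_subtopology_sequence[OF W cover A]
  have "\<mu> \<in> regular_borel_measures (subtopology X W)"
  proof (rule regular_borel_measures_locally_regular[of _ _ A])
    show "Hausdorff_space (subtopology X W)"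
      using Haus by (rule Hausdorff_space_subtopology)
    show "locally_compact_space (subtopology X W)"
      using Haus loc W by (intro locally_compact_space_open_subset) simp_all
    show "\<mu> \<in> borel_measures (subtopology X W)"
      using \<mu> by (simp add: measure_sections_def)
    show "restrict_space \<mu> (A n) \<in> regular_borel_measures (subtopology (subtopology X W) (A n))" for n
      using reg[OF A(1), of n]
      by (simp add: Y(3) regular_measure_sections_def measure_restriction_def)
  qed (rule Y)+
  then show ?thesis
    by (simp add: regular_measure_sections_def)
qed

text \<open>Identity, composition and locality are inherited from all Borel measures. For gluing,
  the family is first glued to a Borel measure, whose restrictions to the cover are regular by
  assumption; regularity being local, the glued measure is regular.\<close>

lemma sheaf_regular_measure_sections:
  assumes sc: "second_countable X" and loc: "locally_compact_space X" and Haus: "Hausdorff_space X"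
  shows "sheaf X (regular_measure_sections X) measure_restriction"
  unfolding sheaf_def
proof (intro conjI allI impI ballI)
  show "presheaf X (regular_measure_sections X) measure_restriction"
    unfolding presheaf_def
  proof (intro conjI allI impI ballI)
    show "measure_restriction U V \<mu> \<in> regular_measure_sections X V"
      if "openin X U" "openin X V" "V \<subseteq> U" "\<mu> \<in> regular_measure_sections X U" for U V \<mu>
      using Haus that by (rule regular_measure_sections_restriction)
  qed (use presheaf_measure_sections[of X] regular_measure_sections_subset[of X]
    in \<open>auto simp: presheaf_def subset_iff\<close>)
  show "\<mu> = \<nu>"
    if "openin X W" "open_cover X W \<U>"
      "\<mu> \<in> regular_measure_sections X W" "\<nu> \<in> regular_measure_sections X W"
      "\<forall>U\<in>\<U>. measure_restriction W U \<mu> = measure_restriction W U \<nu>" for W \<U> \<mu> \<nu>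
    using measure_sections_locality[OF sc that(1,2)] that(3-5) regular_measure_sections_subset by blast
  show "\<exists>\<mu>\<in>regular_measure_sections X W. \<forall>U\<in>\<U>. measure_restriction W U \<mu> = \<sigma> U"
    if W: "openin X W" and cover: "open_cover X W \<U>"
      and \<sigma>: "\<forall>U\<in>\<U>. \<sigma> U \<in> regular_measure_sections X U"
      and compat: "\<forall>U\<in>\<U>. \<forall>V\<in>\<U>.
        measure_restriction U (U \<inter> V) (\<sigma> U) = measure_restriction V (U \<inter> V) (\<sigma> V)" for W \<U> \<sigma>
  proof -
    have "\<sigma> U \<in> measure_sections X U" if "U \<in> \<U>" for U
      using \<sigma> that regular_measure_sections_subset by blast
    then obtain \<mu> where \<mu>: "\<mu> \<in> measure_sections X W"
      and restr: "\<forall>U\<in>\<U>. measure_restriction W U \<mu> = \<sigma> U"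
      using measure_sections_gluing[OF sc W cover, of \<sigma>] compat by blast
    have "\<mu> \<in> regular_measure_sections X W"
      using \<sigma> restr by (intro regular_measure_sections_local[OF assms W cover \<mu>]) simp
    with restr show ?thesis by blast
  qed
qed

theorem proposition3p6:
  fixes X :: "'a topology"
  assumes "second_countable X" and "locally_compact_space X" and "Hausdorff_space X"
  shows "subsheaf X (regular_measure_sections X) measure_restriction
                    (measure_sections X) measure_restriction"
  unfolding subsheaf_def
  by (simp add: assms sheaf_measure_sections sheaf_regular_measure_sections
      regular_measure_sections_subset)

end
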